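(* A pair of functions $(H(\cdot),K(\cdot))\in\Lambda[0,T]\times\Lambda[0,T]$ is a relaxed compensator for Problem (MF-LQ) if and only if the following two groups of inequalities hold (argument $t$ suppressed): $$\text{(i)}\ \left\{\begin{aligned}&\dot H+HA+A^\top H+C^\top HC+Q-[HB+C^\top HD+S][D^\top HD+R]^{-1}[HB+C^\top HD+S]^\top\ge0,\quad t\in[0,T],\\&H(T)\le G,\\&D^\top HD+R\gg0,\quad t\in[0,T],\end{aligned}\right.$$ and $$\text{(ii)}\ \left\{\begin{aligned}&\dot K+K\widehat A+\widehat A^\top K+\widehat C^\top H\widehat C+\widehat Q-[K\widehat B+\widehat C^\top H\widehat D+\widehat S][\widehat D^\top H\widehat D+\widehat R]^{-1}[K\widehat B+\widehat C^\top H\widehat D+\widehat S]^\top\ge0,\quad t\in[0,T],\\&K(T)\le\widehat G,\\&\widehat D^\top H\widehat D+\widehat R\gg0,\quad t\in[0,T].\end{aligned}\right.$$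
   Context: Fix $T>0$ and positive integers $n,m$. $\mathbb S^n$ is the set of symmetric $n\times n$ real matrices, ordered by positive semidefiniteness. $L^\infty(0,T;\mathbb H)$ is the space of $\mathbb H$-valued (deterministic) continuous functions $\varphi$ with $\mathrm{esssup}_{t\in[0,T]}|\varphi(t)|<\infty$. The data of Problem (MF-LQ) (a mean-field linear-quadratic stochastic control problem with these coefficients) are: $A,\widetilde A,C,\widetilde C\in L^\infty(0,T;\mathbb R^{n\times n})$, $B,\widetilde B,D,\widetilde D\in L^\infty(0,T;\mathbb R^{n\times m})$, $Q,\widetilde Q\in L^\infty(0,T;\mathbb S^n)$, $S,\widetilde S\in L^\infty(0,T;\mathbb R^{n\times m})$, $R,\widetilde R\in L^\infty(0,T;\mathbb S^m)$, $G,\widetilde G\in\mathbb S^n$ (no definiteness is assumed). Write $\widehat F=F+\widetilde F$ for each $F\in\{A,B,C,D,Q,S,R,G\}$. For a symmetric-matrix-valued function $f$ on $[0,T]$, $f(\cdot)\ge0$ means $f(t)$ is positive semidefinite for a.e. $t$, and $f(\cdot)\gg0$ means there is a constant $\delta>0$ with $f(\cdot)-\delta I\ge0$. Relaxed compensator: $\Lambda[0,T]$ is the set of functions $F:[0,T]\to\mathbb S^n$ of the form $F(t)=F(0)+\int_0^tf(s)ds$ with $f\in L^\infty(0,T;\mathbb S^n)$. For $(H,K)\in\Lambda[0,T]\times\Lambda[0,T]$ let $$\begin{aligned}&Q^{H,K}=\dot H+HA+A^\top H+C^\top HC+Q,&&\widehat Q^{H,K}=\dot K+K\widehat A+\widehat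 A^\top K+\widehat C^\top H\widehat C+\widehat Q,\\&S^{H,K}=HB+C^\top HD+S,&&\widehat S^{H,K}=K\widehat B+\widehat C^\top H\widehat D+\widehat S,\\&R^{H,K}=D^\top HD+R,&&\widehat R^{H,K}=\widehat D^\top H\widehat D+\widehat R,\\&G^{H,K}=G-H(T),&&\widehat G^{H,K}=\widehat G-K(T),\end{aligned}$$ and $\mathbf Q^{H,K}=\begin{pmatrix}Q^{H,K}&O\\O&\widehat Q^{H,K}\end{pmatrix}$, and likewise $\mathbf S^{H,K},\mathbf R^{H,K},\mathbf G^{H,K}$ (block diagonal with the unhatted and hatted entries). $(H,K)$ is called a relaxed compensator for Problem (MF-LQ) if $$\begin{pmatrix}\mathbf Q^{H,K}(\cdot)&\mathbf S^{H,K}(\cdot)\\\mathbf S^{H,K}(\cdot)^\top&\mathbf R^{H,K}(\cdot)\end{pmatrix}\ge0,\quad\mathbf R^{H,K}(\cdot)\gg0,\quad\mathbf G^{H,K}\ge0.$$ *)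

theory Defs
  imports "HOL-Analysis.Analysis" "HOL-Probability.Essential_Supremum"
begin

definition sym_mats :: "(real^'k^'k) set" where
  "sym_mats = {M. transpose M = M}"

definition psd :: "real^'k^'k \<Rightarrow> bool" where
  "psd M \<longleftrightarrow> M \<in> sym_mats \<and> (\<forall>x. 0 \<le> x \<bullet> (M *v x))"

text \<open>The order of the symmetric matrices; the order that the library has on
  \<^typ>\<open>real^'k^'k\<close> is the componentwise one.\<close>

definition loewner_le :: "real^'k^'k \<Rightarrow> real^'k^'k \<Rightarrow> bool"  (infix "\<preceq>" 50) where
  "M \<preceq> N \<longleftrightarrow> psd (N - M)"

definition ae_psd :: "real \<Rightarrow> (real \<Rightarrow> real^'k^'k) \<Rightarrow> bool" where
  "ae_psd T f \<longleftrightarrow> (AE t in lebesgue_on {0..T}. psd (f t))"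

definition unif_pd :: "real \<Rightarrow> (real \<Rightarrow> real^'k^'k) \<Rightarrow> bool" where
  "unif_pd T f \<longleftrightarrow> (\<exists>\<delta>>0. ae_psd T (\<lambda>t. f t - \<delta> *\<^sub>R mat 1))"

text \<open>The space of essentially bounded measurable functions on the interval from 0 to T
  with values in \<open>X\<close>. Functions are not identified when they agree almost everywhere.
  No continuity is required: bounded functions that are continuous (even only on the
  open interval) are a special case, see \<open>Linf_continuous\<close> below.\<close>

definition Linf :: "real \<Rightarrow> 'h::euclidean_space set \<Rightarrow> (real \<Rightarrow> 'h) set" where
  "Linf T X = {\<phi>. \<phi> \<in> borel_measurable (lebesgue_on {0..T}) \<and> (\<forall>t\<in>{0..T}. \<phi> t \<in> X) \<and>
     esssup (lebesgue_on {0..T}) (\<lambda>t. ereal (norm (\<phi> t))) < \<infinity>}"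

lemma Linf_continuous:
  fixes \<phi> :: "real \<Rightarrow> 'h::euclidean_space"
  assumes cont: "continuous_on {0<..<T} \<phi>"
    and vals: "\<And>t. t \<in> {0..T} \<Longrightarrow> \<phi> t \<in> X"
    and bdd: "bounded (\<phi> ` {0<..<T})"
  shows "\<phi> \<in> Linf T X"
proof -
  have neg: "negligible {0, T}" and eq: "{0..T} - {0, T} = {0<..<T}"
    by auto
  have null: "{0, T} \<in> null_sets (lebesgue_on {0..T})" if "0 \<le> T"
    using neg that by (simp add: null_sets_restrict_space negligible_iff_null_sets)
  have "\<phi> \<in> borel_measurable (lebesgue_on {0<..<T})"
    by (intro continuous_imp_measurable_on_sets_lebesgue cont) auto
  then have meas: "\<phi> \<in> borel_measurable (lebesgue_on {0..T})"
    using borel_measurable_diff_null[of "{0, T}" "{0..T}" \<phi>] null by (cases "0 \<le> T") (simp_all add: eq)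
  obtain C where C: "\<forall>t\<in>{0<..<T}. norm (\<phi> t) \<le> C"
    using bdd by (force simp: bounded_iff)
  have "AE t in lebesgue. t \<notin> {0, T}"
    using neg by (intro AE_not_in) (simp add: negligible_iff_null_sets)
  then have "AE t in lebesgue_on {0..T}. ereal (norm (\<phi> t)) \<le> ereal C"
    by (subst AE_restrict_space_iff, simp, elim eventually_mono) (use C in auto)
  then have "esssup (lebesgue_on {0..T}) (\<lambda>t. ereal (norm (\<phi> t))) \<le> ereal C"
    using meas by (intro esssup_I) auto
  then show ?thesis
    using meas vals by (auto simp: Linf_def intro: le_less_trans[where y = "ereal C"])
qed

definition Lam :: "real \<Rightarrow> (real \<Rightarrow> real^'k^'k) set" where
  "Lam T = {F. (\<forall>t\<in>{0..T}. F t \<in> sym_mats) \<and>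
     (\<exists>f\<in>Linf T sym_mats. \<forall>t\<in>{0..T}. F t = F 0 + integral {0..t} f)}"

text \<open>For \<open>F \<in> Lam T\<close> the derivative exists at almost every \<open>t\<close>; the values of this
  function elsewhere are irrelevant, since it is only used almost everywhere.\<close>

definition dt :: "real \<Rightarrow> (real \<Rightarrow> real^'k^'k) \<Rightarrow> real \<Rightarrow> real^'k^'k" where
  "dt T F t = vector_derivative F (at t within {0..T})"

definition block :: "real^'p^'k \<Rightarrow> real^'q^'k \<Rightarrow> real^'p^'l \<Rightarrow> real^'q^'l \<Rightarrow> real^('p + 'q)^('k + 'l)" where
  "block M11 M12 M21 M22 = (\<chi> i j.
     case i of Inl a \<Rightarrow> (case j of Inl b \<Rightarrow> M11 $ a $ b | Inr b \<Rightarrow> M12 $ a $ b)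
             | Inr a \<Rightarrow> (case j of Inl b \<Rightarrow> M21 $ a $ b | Inr b \<Rightarrow> M22 $ a $ b))"

definition block_diag :: "real^'p^'k \<Rightarrow> real^'q^'l \<Rightarrow> real^('p + 'q)^('k + 'l)" where
  "block_diag M N = block M 0 0 N"

text \<open>The coefficients of Problem (MF-LQ): field \<open>cF\<close> is the coefficient \<open>F\<close>,
  \<open>tF\<close> is \<open>F\<close> with a tilde, and \<open>hF\<close> (below) is \<open>F\<close> with a hat. An \<open>n \<times> m\<close> real
  matrix has type \<^typ>\<open>real^'m^'n\<close>.\<close>

record ('n::finite, 'm::finite) mflq =
  cA :: "real \<Rightarrow> real^'n^'n"
  tA :: "real \<Rightarrow> real^'n^'n"
  cB :: "real \<Rightarrow> real^'m^'n"
  tB :: "real \<Rightarrow> real^'m^'n"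
  cC :: "real \<Rightarrow> real^'n^'n"
  tC :: "real \<Rightarrow> real^'n^'n"
  cD :: "real \<Rightarrow> real^'m^'n"
  tD :: "real \<Rightarrow> real^'m^'n"
  cQ :: "real \<Rightarrow> real^'n^'n"
  tQ :: "real \<Rightarrow> real^'n^'n"
  cS :: "real \<Rightarrow> real^'m^'n"
  tS :: "real \<Rightarrow> real^'m^'n"
  cR :: "real \<Rightarrow> real^'m^'m"
  tR :: "real \<Rightarrow> real^'m^'m"
  cG :: "real^'n^'n"
  tG :: "real^'n^'n"

definition mflq_data :: "real \<Rightarrow> ('n::finite, 'm::finite) mflq \<Rightarrow> bool" where
  "mflq_data T P \<longleftrightarrow>
     cA P \<in> Linf T UNIV \<and> tA P \<in> Linf T UNIV \<and> cC P \<in> Linf T UNIV \<and> tC P \<in> Linf T UNIV \<and>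
     cB P \<in> Linf T UNIV \<and> tB P \<in> Linf T UNIV \<and> cD P \<in> Linf T UNIV \<and> tD P \<in> Linf T UNIV \<and>
     cQ P \<in> Linf T sym_mats \<and> tQ P \<in> Linf T sym_mats \<and>
     cS P \<in> Linf T UNIV \<and> tS P \<in> Linf T UNIV \<and>
     cR P \<in> Linf T sym_mats \<and> tR P \<in> Linf T sym_mats \<and>
     cG P \<in> sym_mats \<and> tG P \<in> sym_mats"

definition "hA P t = cA P t + tA P t"
definition "hB P t = cB P t + tB P t"
definition "hC P t = cC P t + tC P t"
definition "hD P t = cD P t + tD P t"
definition "hQ P t = cQ P t + tQ P t"
definition "hS P t = cS P t + tS P t"
definition "hR P t = cR P t + tR P t"
definition "hG P = cG P + tG P"

text \<open>The entries of the compensated problem: \<open>HK_cF\<close> and \<open>HK_hF\<close> are \<open>F\<close> without and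
  with a hat, and superscript \<open>H,K\<close>.\<close>

definition HK_cQ :: "real \<Rightarrow> ('n::finite, 'm::finite) mflq \<Rightarrow> (real \<Rightarrow> real^'n^'n) \<Rightarrow> (real \<Rightarrow> real^'n^'n) \<Rightarrow> real \<Rightarrow> real^'n^'n" where
  "HK_cQ T P H K t = dt T H t + H t ** cA P t + transpose (cA P t) ** H t
     + transpose (cC P t) ** H t ** cC P t + cQ P t"

definition HK_hQ :: "real \<Rightarrow> ('n::finite, 'm::finite) mflq \<Rightarrow> (real \<Rightarrow> real^'n^'n) \<Rightarrow> (real \<Rightarrow> real^'n^'n) \<Rightarrow> real \<Rightarrow> real^'n^'n" where
  "HK_hQ T P H K t = dt T K t + K t ** hA P t + transpose (hA P t) ** K t
     + transpose (hC P t) ** H t ** hC P t + hQ P t"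

definition HK_cS :: "('n::finite, 'm::finite) mflq \<Rightarrow> (real \<Rightarrow> real^'n^'n) \<Rightarrow> (real \<Rightarrow> real^'n^'n) \<Rightarrow> real \<Rightarrow> real^'m^'n" where
  "HK_cS P H K t = H t ** cB P t + transpose (cC P t) ** H t ** cD P t + cS P t"

definition HK_hS :: "('n::finite, 'm::finite) mflq \<Rightarrow> (real \<Rightarrow> real^'n^'n) \<Rightarrow> (real \<Rightarrow> real^'n^'n) \<Rightarrow> real \<Rightarrow> real^'m^'n" where
  "HK_hS P H K t = K t ** hB P t + transpose (hC P t) ** H t ** hD P t + hS P t"

definition HK_cR :: "('n::finite, 'm::finite) mflq \<Rightarrow> (real \<Rightarrow> real^'n^'n) \<Rightarrow> (real \<Rightarrow> real^'n^'n) \<Rightarrow> real \<Rightarrow> real^'m^'m" where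
  "HK_cR P H K t = transpose (cD P t) ** H t ** cD P t + cR P t"

definition HK_hR :: "('n::finite, 'm::finite) mflq \<Rightarrow> (real \<Rightarrow> real^'n^'n) \<Rightarrow> (real \<Rightarrow> real^'n^'n) \<Rightarrow> real \<Rightarrow> real^'m^'m" where
  "HK_hR P H K t = transpose (hD P t) ** H t ** hD P t + hR P t"

definition HK_cG :: "real \<Rightarrow> ('n::finite, 'm::finite) mflq \<Rightarrow> (real \<Rightarrow> real^'n^'n) \<Rightarrow> (real \<Rightarrow> real^'n^'n) \<Rightarrow> real^'n^'n" where
  "HK_cG T P H K = cG P - H T"

definition HK_hG :: "real \<Rightarrow> ('n::finite, 'm::finite) mflq \<Rightarrow> (real \<Rightarrow> real^'n^'n) \<Rightarrow> (real \<Rightarrow> real^'n^'n) \<Rightarrow> real^'n^'n" where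
  "HK_hG T P H K = hG P - K T"

definition HK_Q :: "real \<Rightarrow> ('n::finite, 'm::finite) mflq \<Rightarrow> (real \<Rightarrow> real^'n^'n) \<Rightarrow> (real \<Rightarrow> real^'n^'n) \<Rightarrow> real \<Rightarrow> real^('n + 'n)^('n + 'n)" where
  "HK_Q T P H K t = block_diag (HK_cQ T P H K t) (HK_hQ T P H K t)"

definition HK_S :: "('n::finite, 'm::finite) mflq \<Rightarrow> (real \<Rightarrow> real^'n^'n) \<Rightarrow> (real \<Rightarrow> real^'n^'n) \<Rightarrow> real \<Rightarrow> real^('m + 'm)^('n + 'n)" where
  "HK_S P H K t = block_diag (HK_cS P H K t) (HK_hS P H K t)"

definition HK_R :: "('n::finite, 'm::finite) mflq \<Rightarrow> (real \<Rightarrow> real^'n^'n) \<Rightarrow> (real \<Rightarrow> real^'n^'n) \<Rightarrow> real \<Rightarrow> real^('m + 'm)^('m + 'm)" where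
  "HK_R P H K t = block_diag (HK_cR P H K t) (HK_hR P H K t)"

definition HK_G :: "real \<Rightarrow> ('n::finite, 'm::finite) mflq \<Rightarrow> (real \<Rightarrow> real^'n^'n) \<Rightarrow> (real \<Rightarrow> real^'n^'n) \<Rightarrow> real^('n + 'n)^('n + 'n)" where
  "HK_G T P H K = block_diag (HK_cG T P H K) (HK_hG T P H K)"

definition relaxed_compensator :: "real \<Rightarrow> ('n::finite, 'm::finite) mflq \<Rightarrow> (real \<Rightarrow> real^'n^'n) \<Rightarrow> (real \<Rightarrow> real^'n^'n) \<Rightarrow> bool" where
  "relaxed_compensator T P H K \<longleftrightarrow>
     H \<in> Lam T \<and> K \<in> Lam T \<and>
     ae_psd T (\<lambda>t. block (HK_Q T P H K t) (HK_S P H K t)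
                         (transpose (HK_S P H K t)) (HK_R P H K t)) \<and>
     unif_pd T (HK_R P H K) \<and>
     psd (HK_G T P H K)"

end

theory Submission
  imports Defs
begin

text \<open>
  The equivalence is pointwise in time and rests on the Schur complement. Where
  the weight \<open>R\<close> is positive definite, completing the square in the second variable gives

    \<open>u \<bullet> Qu + 2 (u \<bullet> Sv) + v \<bullet> Rv = u \<bullet> (Q - S R' S\<^sup>T)u + (v + R' S\<^sup>T u) \<bullet> R(v + R' S\<^sup>T u)\<close>

  with \<open>R'\<close> the inverse of \<open>R\<close>. The last term is nonnegative, and vanishes for a suitable \<open>v\<close>.
  So the block matrix with entries \<open>Q\<close>, \<open>S\<close>, \<open>S\<^sup>T\<close>, \<open>R\<close> is positive semidefinite exactly if
  the Schur complement \<open>Q - S R' S\<^sup>T\<close> is (\<open>psd_block_iff_schur_complement\<close>).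

  It remains to see that the three conditions on a relaxed compensator decouple into the
  unhatted and the hatted ones. For the terminal and the control weights, which are block
  diagonal, this is \<open>psd_block_diag_iff\<close>. In the big matrix the two problems are interleaved: its
  quadratic form is the sum of the quadratic forms of the two smaller block matrices in
  independent variables, hence \<open>psd_block_block_diag_iff\<close>. Uniform positivity of the control
  weights is one of the conditions on either side, so that at almost every time the Schur
  complement may be used.
\<close>

section \<open>Block matrices and their quadratic forms\<close>

definition join_vec :: "real^'k \<Rightarrow> real^'l \<Rightarrow> real^('k + 'l)" where
  "join_vec u v = (\<chi> i. case i of Inl a \<Rightarrow> u $ a | Inr b \<Rightarrow> v $ b)"

lemma all_vec_sum_iff:
  "(\<forall>x :: real^('k::finite + 'l::finite). A x) \<longleftrightarrow> (\<forall>u v. A (join_vec u v))"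
proof -
  have "\<exists>u v. x = join_vec u v" for x :: "real^('k + 'l)"
    by (intro exI[of _ "\<chi> a. x $ Inl a"] exI[of _ "\<chi> b. x $ Inr b"])
       (simp add: vec_eq_iff join_vec_def split: sum.split)
  then show ?thesis
    by metis
qed

lemma sum_UNIV_sum_type:
  "sum f (UNIV :: ('k::finite + 'l::finite) set) = (\<Sum>a\<in>UNIV. f (Inl a)) + (\<Sum>b\<in>UNIV. f (Inr b))"
  using sum.Plus[of "UNIV :: 'k set" "UNIV :: 'l set" f] by (simp add: UNIV_Plus_UNIV)

lemma inner_join_vec: "join_vec u v \<bullet> join_vec u' v' = u \<bullet> u' + v \<bullet> v'"
  by (simp add: inner_vec_def join_vec_def sum_UNIV_sum_type)

lemma block_mult_join_vec:
  "block M11 M12 M21 M22 *v join_vec u v = join_vec (M11 *v u + M12 *v v) (M21 *v u + M22 *v v)"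
  by (simp add: vec_eq_iff block_def join_vec_def matrix_vector_mult_def sum_UNIV_sum_type
      split: sum.split)

lemma transpose_block:
  "transpose (block M11 M12 M21 M22)
     = block (transpose M11) (transpose M21) (transpose M12) (transpose M22)"
  by (simp add: vec_eq_iff block_def transpose_def split: sum.split)

lemma transpose_0: "transpose (0 :: real^'a^'b) = 0"
  by (simp add: vec_eq_iff transpose_def)

lemma block_eq_iff:
  "block M11 M12 M21 M22 = block N11 N12 N21 N22
     \<longleftrightarrow> M11 = N11 \<and> M12 = N12 \<and> M21 = N21 \<and> M22 = N22"
proof
  assume eq: "block M11 M12 M21 M22 = block N11 N12 N21 N22"
  have *: "block M11 M12 M21 M22 $ i $ j = block N11 N12 N21 N22 $ i $ j" for i j
    by (simp add: eq)
  show "M11 = N11 \<and> M12 = N12 \<and> M21 = N21 \<and> M22 = N22"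
    using *[of "Inl _" "Inl _"] *[of "Inl _" "Inr _"] *[of "Inr _" "Inl _"] *[of "Inr _" "Inr _"]
    by (simp add: block_def vec_eq_iff)
qed simp

lemma inner_mult_transpose:
  fixes M :: "real^'l^'k"
  shows "u \<bullet> (M *v v) = v \<bullet> (transpose M *v u)"
  by (simp only: transpose_matrix_vector dot_lmul_matrix[symmetric] inner_commute)

lemma psd_block_iff:
  fixes Q :: "real^'k^'k" and S :: "real^'l^'k" and R :: "real^'l^'l"
  shows "psd (block Q S (transpose S) R) \<longleftrightarrow>
    transpose Q = Q \<and> transpose R = R \<and>
    (\<forall>u v. 0 \<le> u \<bullet> (Q *v u) + 2 * (u \<bullet> (S *v v)) + v \<bullet> (R *v v))"
proof -
  have "v \<bullet> (transpose S *v u) = u \<bullet> (S *v v)" for u v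
    by (simp add: inner_mult_transpose[of u])
  then have "join_vec u v \<bullet> (block Q S (transpose S) R *v join_vec u v)
      = u \<bullet> (Q *v u) + 2 * (u \<bullet> (S *v v)) + v \<bullet> (R *v v)" for u v
    by (simp add: block_mult_join_vec inner_join_vec inner_add_right)
  then show ?thesis
    by (auto simp: psd_def sym_mats_def transpose_block block_eq_iff all_vec_sum_iff)
qed

section \<open>Decoupling\<close>

text \<open>The quadratic form is a sum of two forms in independent variables; put either variable
  to zero.\<close>

lemma psd_block_diag_iff: "psd (block_diag M N) \<longleftrightarrow> psd M \<and> psd N"
proof -
  have "(\<forall>u v. 0 \<le> u \<bullet> (M *v u) + v \<bullet> (N *v v)) \<longleftrightarrow>
      (\<forall>u. 0 \<le> u \<bullet> (M *v u)) \<and> (\<forall>v. 0 \<le> v \<bullet> (N *v v))" (is "?l \<longleftrightarrow> ?r")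
  proof
    assume l: ?l
    have "0 \<le> u \<bullet> (M *v u)" "0 \<le> v \<bullet> (N *v v)" for u v
      using spec[OF spec[OF l, of u], of 0] spec[OF spec[OF l, of 0], of v] by simp_all
    then show ?r
      by blast
  qed simp
  then show ?thesis
    using psd_block_iff[of M 0 N] by (auto simp: block_diag_def transpose_0 psd_def sym_mats_def)
qed

text \<open>Regrouping the variables \<open>(u\<^sub>1, u\<^sub>2, v\<^sub>1, v\<^sub>2)\<close> as \<open>(u\<^sub>1, v\<^sub>1, u\<^sub>2, v\<^sub>2)\<close>
  turns the matrix into a block diagonal one. The quadratic form is then a sum of two forms,
  each of which is seen alone when the variables of the other are zero.\<close>

lemma psd_block_block_diag_iff:
  "psd (block (block_diag Q1 Q2) (block_diag S1 S2) (transpose (block_diag S1 S2)) (block_diag R1 R2))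
     \<longleftrightarrow> psd (block Q1 S1 (transpose S1) R1) \<and> psd (block Q2 S2 (transpose S2) R2)"
proof -
  define q1 where "q1 u v = u \<bullet> (Q1 *v u) + 2 * (u \<bullet> (S1 *v v)) + v \<bullet> (R1 *v v)" for u v
  define q2 where "q2 u v = u \<bullet> (Q2 *v u) + 2 * (u \<bullet> (S2 *v v)) + v \<bullet> (R2 *v v)" for u v
  have sym: "transpose (block_diag M N) = block_diag M N \<longleftrightarrow> transpose M = M \<and> transpose N = N"
    for M :: "real^'i^'i" and N :: "real^'j^'j"
    by (simp add: block_diag_def transpose_block block_eq_iff transpose_0)
  have form: "join_vec u1 u2 \<bullet> (block_diag Q1 Q2 *v join_vec u1 u2)
      + 2 * (join_vec u1 u2 \<bullet> (block_diag S1 S2 *v join_vec v1 v2))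
      + join_vec v1 v2 \<bullet> (block_diag R1 R2 *v join_vec v1 v2) = q1 u1 v1 + q2 u2 v2"
    for u1 u2 v1 v2
    by (simp add: block_diag_def block_mult_join_vec inner_join_vec q1_def q2_def)
  have "(\<forall>u1 u2 v1 v2. 0 \<le> q1 u1 v1 + q2 u2 v2) \<longleftrightarrow>
      (\<forall>u v. 0 \<le> q1 u v) \<and> (\<forall>u v. 0 \<le> q2 u v)" (is "?l \<longleftrightarrow> ?r")
  proof
    assume l: ?l
    have "0 \<le> q1 u v + q2 0 0" "0 \<le> q1 0 0 + q2 u' v'" for u v u' v'
      using l by blast+
    moreover have "q1 0 0 = 0" "q2 0 0 = 0"
      by (simp_all add: q1_def q2_def)
    ultimately show ?r
      by simp
  qed simp
  then show ?thesis
    unfolding psd_block_iff[where Q = "block_diag Q1 Q2"] all_vec_sum_iff form sym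
    unfolding psd_block_iff q1_def q2_def by auto
qed

lemma block_diag_minus_scaled_mat_1:
  "block_diag M N - \<delta> *\<^sub>R mat 1 = block_diag (M - \<delta> *\<^sub>R mat 1) (N - \<delta> *\<^sub>R mat 1)"
  by (simp add: vec_eq_iff block_diag_def block_def mat_def split: sum.split)

lemma psd_minus_scaled_mat_1_mono:
  assumes "psd (M - \<delta> *\<^sub>R mat 1)" and "\<epsilon> \<le> \<delta>"
  shows "psd (M - \<epsilon> *\<^sub>R mat 1)"
proof -
  have sym: "M - \<gamma> *\<^sub>R mat 1 \<in> sym_mats \<longleftrightarrow> M \<in> sym_mats" for \<gamma>
  proof -
    have "transpose (M - \<gamma> *\<^sub>R mat 1) = transpose M - \<gamma> *\<^sub>R mat 1"
      by (simp add: transpose_def vec_eq_iff mat_def)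
    then show ?thesis
      by (simp add: sym_mats_def)
  qed
  have "x \<bullet> ((M - \<gamma> *\<^sub>R mat 1) *v x) = x \<bullet> (M *v x) - \<gamma> * (x \<bullet> x)" for \<gamma> x
    by (simp add: matrix_vector_mult_diff_rdistrib inner_diff_right
        scaleR_matrix_vector_assoc[symmetric])
  moreover have "\<epsilon> * (x \<bullet> x) \<le> \<delta> * (x \<bullet> x)" for x :: "real^'a"
    using assms(2) by (simp add: mult_right_mono)
  ultimately show ?thesis
    using assms(1) unfolding psd_def sym by (smt (verit))
qed

text \<open>The two bounds for the diagonal blocks may differ; their minimum serves for both.\<close>

lemma unif_pd_block_diag_iff:
  "unif_pd T (\<lambda>t. block_diag (f t) (g t)) \<longleftrightarrow> unif_pd T f \<and> unif_pd T g"
proof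
  assume "unif_pd T (\<lambda>t. block_diag (f t) (g t))"
  then show "unif_pd T f \<and> unif_pd T g"
    unfolding unif_pd_def ae_psd_def block_diag_minus_scaled_mat_1 psd_block_diag_iff by auto
next
  assume "unif_pd T f \<and> unif_pd T g"
  then obtain \<delta> \<epsilon> where pos: "\<delta> > 0" "\<epsilon> > 0"
    and "ae_psd T (\<lambda>t. f t - \<delta> *\<^sub>R mat 1)" "ae_psd T (\<lambda>t. g t - \<epsilon> *\<^sub>R mat 1)"
    by (auto simp: unif_pd_def)
  then have "AE t in lebesgue_on {0..T}. psd (f t - \<delta> *\<^sub>R mat 1) \<and> psd (g t - \<epsilon> *\<^sub>R mat 1)"
    by (simp add: ae_psd_def)
  then have "AE t in lebesgue_on {0..T}.
      psd (f t - min \<delta> \<epsilon> *\<^sub>R mat 1) \<and> psd (g t - min \<delta> \<epsilon> *\<^sub>R mat 1)"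
    by (rule eventually_mono) (auto elim: psd_minus_scaled_mat_1_mono)
  then show "unif_pd T (\<lambda>t. block_diag (f t) (g t))"
    unfolding unif_pd_def ae_psd_def block_diag_minus_scaled_mat_1 psd_block_diag_iff
    using pos by (intro exI[of _ "min \<delta> \<epsilon>"]) simp
qed

section \<open>The Schur complement\<close>

lemma posdef_imp_invertible:
  fixes R :: "real^'k^'k"
  assumes "\<And>x. x \<noteq> 0 \<Longrightarrow> 0 < x \<bullet> (R *v x)"
  shows "invertible R"
proof -
  have "x = 0" if "R *v x = 0" for x
    using assms[of x] that by auto
  then show ?thesis
    by (auto simp: invertible_left_inverse matrix_left_invertible_ker)
qed

lemma matrix_inv_cancel:
  assumes "invertible A"
  shows "A ** matrix_inv A = mat 1" and "matrix_inv A ** A = mat 1"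
  using someI_ex[OF assms[unfolded invertible_def]] by (simp_all add: matrix_inv_def)

lemma transpose_matrix_inv:
  fixes R :: "real^'k^'k"
  assumes "invertible R" and "transpose R = R"
  shows "transpose (matrix_inv R) = matrix_inv R"
proof -
  have inv: "R ** matrix_inv R = mat 1" "matrix_inv R ** R = mat 1"
    using assms(1) by (simp_all add: matrix_inv_cancel)
  then have "transpose (matrix_inv R) ** R = mat 1"
    by (metis assms(2) matrix_transpose_mul transpose_mat)
  then show ?thesis
    by (metis inv(1) matrix_mul_assoc matrix_mul_lid matrix_mul_rid)
qed

text \<open>Completing the square. Symmetry of \<open>Q\<close> is part of either side, because the subtracted
  term \<open>N\<close> is symmetric.\<close>

lemma psd_block_iff_schur_complement:
  fixes Q :: "real^'k^'k" and S :: "real^'l^'k" and R :: "real^'l^'l"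
  assumes sym: "transpose R = R" and pos: "\<And>x. x \<noteq> 0 \<Longrightarrow> 0 < x \<bullet> (R *v x)"
  shows "psd (block Q S (transpose S) R) \<longleftrightarrow> psd (Q - S ** matrix_inv R ** transpose S)"
proof -
  define N where "N = S ** matrix_inv R ** transpose S"
  define w where "w u = matrix_inv R *v (transpose S *v u)" for u
  have inv: "invertible R"
    using pos by (rule posdef_imp_invertible)
  have N_sym: "transpose N = N"
    by (simp add: N_def matrix_transpose_mul transpose_matrix_inv[OF inv sym] matrix_mul_assoc)
  have "transpose (Q - N) = transpose Q - transpose N"
    by (simp add: transpose_def vec_eq_iff)
  then have Q_sym: "transpose (Q - N) = Q - N \<longleftrightarrow> transpose Q = Q"
    by (simp add: N_sym)
  have Rw: "R *v w u = transpose S *v u" for u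
    by (simp add: w_def matrix_vector_mul_assoc matrix_mul_assoc matrix_inv_cancel(1)[OF inv])
  have Nu: "N *v u = S *v w u" for u
    by (simp add: N_def w_def matrix_vector_mul_assoc matrix_mul_assoc del: transpose_matrix_vector)
  \<comment> \<open>\<open>- w u\<close> is the minimizer in \<open>v\<close> of the quadratic form.\<close>
  have square: "u \<bullet> (Q *v u) + 2 * (u \<bullet> (S *v v)) + v \<bullet> (R *v v)
      = u \<bullet> ((Q - N) *v u) + (v + w u) \<bullet> (R *v (v + w u))" for u v
  proof -
    have R_w: "x \<bullet> (R *v w u) = u \<bullet> (S *v x)" for x
      by (simp only: Rw inner_mult_transpose[of u S])
    moreover have "w u \<bullet> (R *v v) = u \<bullet> (S *v v)"
      using inner_mult_transpose[of "w u" R v] by (simp only: sym R_w)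
    ultimately show ?thesis
      by (simp add: matrix_vector_mult_diff_rdistrib matrix_vector_right_distrib Nu
          inner_add_left inner_add_right inner_diff_right)
  qed
  have R_nonneg: "0 \<le> x \<bullet> (R *v x)" for x
    using pos[of x] by (cases "x = 0") auto
  have "(\<forall>u v. 0 \<le> u \<bullet> ((Q - N) *v u) + (v + w u) \<bullet> (R *v (v + w u)))
      \<longleftrightarrow> (\<forall>u. 0 \<le> u \<bullet> ((Q - N) *v u))" (is "?l \<longleftrightarrow> ?r")
  proof
    assume l: ?l
    show ?r
    proof
      fix u
      show "0 \<le> u \<bullet> ((Q - N) *v u)"
        using spec[OF spec[OF l, of u], of "- w u"] by simp
    qed
  qed (simp add: R_nonneg)
  then show ?thesis
    unfolding psd_block_iff square N_def[symmetric] using Q_sym sym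
    by (simp add: psd_def sym_mats_def)
qed

lemma psd_minus_scaled_mat_1_imp_posdef:
  assumes "psd (R - \<delta> *\<^sub>R mat 1)" and "\<delta> > 0"
  shows "transpose R = R" and "x \<noteq> 0 \<Longrightarrow> 0 < x \<bullet> (R *v x)"
proof -
  show "transpose R = R"
    using psd_minus_scaled_mat_1_mono[OF assms(1), of 0] assms(2) by (simp add: psd_def sym_mats_def)
  have "0 \<le> x \<bullet> ((R - \<delta> *\<^sub>R mat 1) *v x)"
    using assms(1) by (simp add: psd_def)
  then have "\<delta> * (x \<bullet> x) \<le> x \<bullet> (R *v x)"
    by (simp add: matrix_vector_mult_diff_rdistrib inner_diff_right
        scaleR_matrix_vector_assoc[symmetric])
  moreover assume "x \<noteq> 0"
  then have "0 < \<delta> * (x \<bullet> x)"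
    using assms(2) by simp
  ultimately show "0 < x \<bullet> (R *v x)"
    by linarith
qed

text \<open>Uniform positivity makes \<open>R t\<close> positive definite outside a null set, where the pointwise
  result applies.\<close>

lemma ae_psd_block_iff_schur_complement:
  assumes "unif_pd T R"
  shows "ae_psd T (\<lambda>t. block (Q t) (S t) (transpose (S t)) (R t)) \<longleftrightarrow>
    ae_psd T (\<lambda>t. Q t - S t ** matrix_inv (R t) ** transpose (S t))"
proof -
  obtain \<delta> where \<delta>: "\<delta> > 0" and "AE t in lebesgue_on {0..T}. psd (R t - \<delta> *\<^sub>R mat 1)"
    using assms by (auto simp: unif_pd_def ae_psd_def)
  then have "AE t in lebesgue_on {0..T}. psd (block (Q t) (S t) (transpose (S t)) (R t)) \<longleftrightarrow>
      psd (Q t - S t ** matrix_inv (R t) ** transpose (S t))"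
    by (auto elim!: eventually_mono
        intro!: psd_block_iff_schur_complement psd_minus_scaled_mat_1_imp_posdef[OF _ \<delta>])
  then show ?thesis
    unfolding ae_psd_def by (rule eventually_cong)
qed

section \<open>Characterization of relaxed compensators\<close>

theorem proposition4p9:
  fixes T :: real
    and P :: "('n::finite, 'm::finite) mflq"
    and H K :: "real \<Rightarrow> real^'n^'n"
  assumes "T > 0" and "mflq_data T P" and "H \<in> Lam T" and "K \<in> Lam T"
  shows "relaxed_compensator T P H K \<longleftrightarrow>
    (ae_psd T (\<lambda>t.
        dt T H t + H t ** cA P t + transpose (cA P t) ** H t
          + transpose (cC P t) ** H t ** cC P t + cQ P t
        - (H t ** cB P t + transpose (cC P t) ** H t ** cD P t + cS P t)
          ** matrix_inv (transpose (cD P t) ** H t ** cD P t + cR P t)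
          ** transpose (H t ** cB P t + transpose (cC P t) ** H t ** cD P t + cS P t)) \<and>
     H T \<preceq> cG P \<and>
     unif_pd T (\<lambda>t. transpose (cD P t) ** H t ** cD P t + cR P t)) \<and>
    (ae_psd T (\<lambda>t.
        dt T K t + K t ** hA P t + transpose (hA P t) ** K t
          + transpose (hC P t) ** H t ** hC P t + hQ P t
        - (K t ** hB P t + transpose (hC P t) ** H t ** hD P t + hS P t)
          ** matrix_inv (transpose (hD P t) ** H t ** hD P t + hR P t)
          ** transpose (K t ** hB P t + transpose (hC P t) ** H t ** hD P t + hS P t)) \<and>
     K T \<preceq> hG P \<and>
     unif_pd T (\<lambda>t. transpose (hD P t) ** H t ** hD P t + hR P t))"
proof -
  let ?Qc = "HK_cQ T P H K" and ?Sc = "HK_cS P H K" and ?Rc = "HK_cR P H K"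
  let ?Qh = "HK_hQ T P H K" and ?Sh = "HK_hS P H K" and ?Rh = "HK_hR P H K"
  have R: "unif_pd T (HK_R P H K) \<longleftrightarrow> unif_pd T ?Rc \<and> unif_pd T ?Rh"
    using unif_pd_block_diag_iff[of T ?Rc ?Rh] by (simp add: HK_R_def[abs_def])
  have G: "psd (HK_G T P H K) \<longleftrightarrow> H T \<preceq> cG P \<and> K T \<preceq> hG P"
    by (simp add: HK_G_def psd_block_diag_iff loewner_le_def HK_cG_def HK_hG_def)
  have "ae_psd T (\<lambda>t. block (HK_Q T P H K t) (HK_S P H K t)
          (transpose (HK_S P H K t)) (HK_R P H K t)) \<longleftrightarrow>
      ae_psd T (\<lambda>t. block (?Qc t) (?Sc t) (transpose (?Sc t)) (?Rc t)) \<and>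
      ae_psd T (\<lambda>t. block (?Qh t) (?Sh t) (transpose (?Sh t)) (?Rh t))"
    by (simp add: ae_psd_def HK_Q_def HK_S_def HK_R_def psd_block_block_diag_iff)
  then have "relaxed_compensator T P H K \<longleftrightarrow>
      (ae_psd T (\<lambda>t. ?Qc t - ?Sc t ** matrix_inv (?Rc t) ** transpose (?Sc t)) \<and>
        H T \<preceq> cG P \<and> unif_pd T ?Rc) \<and>
      (ae_psd T (\<lambda>t. ?Qh t - ?Sh t ** matrix_inv (?Rh t) ** transpose (?Sh t)) \<and>
        K T \<preceq> hG P \<and> unif_pd T ?Rh)"
    unfolding relaxed_compensator_def R G
    using assms(3,4) ae_psd_block_iff_schur_complement[of T ?Rc ?Qc ?Sc]
      ae_psd_block_iff_schur_complement[of T ?Rh ?Qh ?Sh] by blast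
  then show ?thesis
    by (simp only: HK_cQ_def HK_cS_def HK_cR_def[abs_def] HK_hQ_def HK_hS_def HK_hR_def[abs_def])
qed

end
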